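(* Let $N>0$ be an integer. There is no integer $C$ such that for every integer $n\ge 0$ there exists an integer index $j\ge 0$ (depending on $n$ and $N$) with $$\sum_{i=0}^{4N+1} P(n+i) = C\cdot P(j).$$
   Context: The Pell numbers are defined by $P(0)=0$, $P(1)=1$ and $P(n)=2P(n-1)+P(n-2)$ for $n\ge 2$. *)

theory Defs imports Main
begin

fun pell :: "nat \<Rightarrow> int" where
  "pell 0 = 0"
| "pell (Suc 0) = 1"
| "pell (Suc (Suc n)) = 2 * pell (Suc n) + pell n"

end

(* Put m = 2N + 1, x = P(m), y = P(m + 1). The sums for n = 0 and n = 1 are (y - x)^2 and
   (y - x)(y + x), whose quotient lies strictly between 2 and 3; hence if they are C P(j) and C P(j'),
   then j' = j + 1. The quadratic form b^2 - 2ab - a^2 takes the value (-1)^j at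
   (P(j), P(j + 1)), and it takes the value 2(y - x)^2 at the two sums. So C^2 = 2(y - x)^2 up to sign,
   which is impossible because y - x is odd. *)
theory Submission imports Defs
begin

lemma pell_nonneg: "pell n \<ge> 0"
  by (induction n rule: pell.induct) auto

lemma pell_le_Suc: "pell n \<le> pell (Suc n)"
  by (cases n) (use pell_nonneg in \<open>auto simp: algebra_simps\<close>)

lemma pell_mono: "m \<le> n \<Longrightarrow> pell m \<le> pell n"
  by (rule lift_Suc_mono_le[of pell]) (rule pell_le_Suc)

lemma pell_add: "pell (Suc (m + n)) = pell (Suc m) * pell (Suc n) + pell m * pell n"
  by (induction m rule: pell.induct) (simp_all add: algebra_simps)

text \<open>The shift (a, b) to (b, 2b + a) negates the form b^2 - 2ab - a^2.\<close>

lemma pell_norm: "(pell (Suc n))\<^sup>2 - 2 * pell n * pell (Suc n) - (pell n)\<^sup>2 = (-1) ^ n"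
proof (induction n)
  case (Suc n)
  then show ?case
    by (simp add: power2_eq_square algebra_simps)
qed simp

lemma odd_pell_Suc_diff: "odd (pell (Suc n) - pell n)"
proof (induction n)
  case (Suc n)
  have "pell (Suc (Suc n)) - pell (Suc n) = (pell (Suc n) - pell n) + 2 * pell n"
    by simp
  then show ?case
    using Suc by presburger
qed simp

text \<open>Telescoping: by the recurrence, 2P(i) = (P(i+2) - P(i+1)) - (P(i+1) - P(i)).\<close>

lemma sum_pell:
  "2 * (\<Sum>i = 0..k. pell (n + i)) =
     (pell (Suc (Suc (n + k))) - pell (Suc (n + k))) - (pell (Suc n) - pell n)"
  by (induction k) (simp_all add: algebra_simps)

text \<open>Monotonicity excludes j' \<le> j, and P(j+2) = 2P(j+1) + P(j) \<ge> 3P(j) excludes j'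
  \<ge> j+2.\<close>

lemma pell_Suc_of_ratio:
  assumes "2 * pell j < pell j'" and "pell j' < 3 * pell j"
  shows "j' = Suc j"
proof -
  have pos: "pell j > 0"
    using assms by linarith
  have "\<not> j' \<le> j"
    using assms(1) pos pell_mono[of j' j] by linarith
  moreover have "\<not> Suc (Suc j) \<le> j'"
  proof
    assume "Suc (Suc j) \<le> j'"
    then have "2 * pell (Suc j) + pell j \<le> pell j'"
      using pell_mono by fastforce
    then show False
      using assms(2) pell_le_Suc[of j] by linarith
  qed
  ultimately show ?thesis
    by linarith
qed

text \<open>After telescoping, each doubled sum is a quadratic form in P(m), P(m+1) minus 1. For odd
  m this -1 is the value of the form in \<open>pell_norm\<close>, so everything becomes homogeneous
  and factors.\<close>

lemma sum_pell_odd: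
  assumes "odd m"
  shows "(\<Sum>i = 0..2 * m - 1. pell i) = (pell (Suc m) - pell m)\<^sup>2"
    and "(\<Sum>i = 0..2 * m - 1. pell (Suc i)) = (pell (Suc m) - pell m) * (pell (Suc m) + pell m)"
proof -
  obtain l where m: "m = Suc l"
    using assms by (cases m) auto
  define x y where "x = pell m" and "y = pell (Suc m)"
  have norm: "y\<^sup>2 - 2 * x * y - x\<^sup>2 = -1"
    using pell_norm[of m] assms by (simp add: x_def y_def)
  have double: "2 * m = Suc (m + l)" "2 * m = m + m"
    by (simp_all add: m)
  \<comment> \<open>Here \<open>y - 2 * x\<close> is P(m-1), that is \<open>pell l\<close>.\<close>
  have P0: "pell (2 * m) = y * x + x * (y - 2 * x)"
    unfolding double(1) pell_add by (simp add: x_def y_def m)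
  have P1: "pell (Suc (2 * m)) = y * y + x * x"
    unfolding double(2) pell_add by (simp add: x_def y_def)
  have "2 * (\<Sum>i = 0..2 * m - 1. pell i) = 2 * (y - x)\<^sup>2"
    using sum_pell[of 0 "2 * m - 1"] P0 P1 norm
    by (simp add: m power2_eq_square algebra_simps)
  then show "(\<Sum>i = 0..2 * m - 1. pell i) = (pell (Suc m) - pell m)\<^sup>2"
    by (simp add: x_def y_def)
  have "2 * (\<Sum>i = 0..2 * m - 1. pell (Suc i)) = 2 * ((y - x) * (y + x))"
    using sum_pell[of 1 "2 * m - 1"] P0 P1 norm
    by (simp add: m power2_eq_square algebra_simps)
  then show "(\<Sum>i = 0..2 * m - 1. pell (Suc i)) =
      (pell (Suc m) - pell m) * (pell (Suc m) + pell m)"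
    by (simp add: x_def y_def)
qed

theorem theorem4p1:
  fixes N :: nat
  assumes "N > 0"
  shows "\<not> (\<exists>C::int. \<forall>n::nat. \<exists>j::nat. (\<Sum>i = 0..4 * N + 1. pell (n + i)) = C * pell j)"
proof
  assume "\<exists>C::int. \<forall>n::nat. \<exists>j::nat. (\<Sum>i = 0..4 * N + 1. pell (n + i)) = C * pell j"
  then obtain C where C: "\<And>n. \<exists>j. (\<Sum>i = 0..4 * N + 1. pell (n + i)) = C * pell j"
    by blast
  define m where "m = 2 * N + 1"
  define x y where "x = pell m" and "y = pell (Suc m)"
  have m: "odd m" "4 * N + 1 = 2 * m - 1"
    by (auto simp: m_def)
  obtain j where j: "(y - x)\<^sup>2 = C * pell j"
    using C[of 0, unfolded m(2)] sum_pell_odd(1)[OF m(1)] by (auto simp: x_def y_def)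
  obtain j' where j': "(y - x) * (y + x) = C * pell j'"
    using C[of 1, unfolded m(2)] sum_pell_odd(2)[OF m(1)] by (auto simp: x_def y_def)

  \<comment> \<open>N > 0 enters here: it makes P(m-1) positive, so both bounds on y/x are strict;
    for m = 1 one has y = 2x.\<close>
  obtain l where l: "m = Suc (Suc l)"
    using assms by (cases N) (auto simp: m_def)
  have "0 < pell (Suc l)"
    using pell_mono[of 1 "Suc l"] by simp
  then have xy: "2 * x < y" "y < 3 * x" "0 < y - x"
    using pell_nonneg[of l] by (simp_all add: x_def y_def l)
  have "C * pell j > 0"
    using j xy(3) by (metis zero_less_power)
  then have "C > 0"
    using pell_nonneg[of j] by (simp add: zero_less_mult_iff)
  \<comment> \<open>2(y - x) < y + x amounts to y < 3x, and y + x < 3(y - x) to 2x < y.\<close>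
  have "(y - x) * (2 * (y - x)) < (y - x) * (y + x)" "(y - x) * (y + x) < (y - x) * (3 * (y - x))"
    using xy by (auto intro!: mult_strict_left_mono)
  then have "C * (2 * pell j) < C * pell j'" "C * pell j' < C * (3 * pell j)"
    using j j' by (simp_all add: power2_eq_square algebra_simps)
  then have "j' = Suc j"
    using \<open>C > 0\<close> by (intro pell_Suc_of_ratio) simp_all

  have norm: "y\<^sup>2 - 2 * x * y - x\<^sup>2 = -1"
    using pell_norm[of m] m(1) by (simp add: x_def y_def)
  have "C\<^sup>2 * (-1) ^ j = (C * pell j')\<^sup>2 - 2 * (C * pell j) * (C * pell j') - (C * pell j)\<^sup>2"
    unfolding \<open>j' = Suc j\<close> pell_norm[symmetric] by (simp add: power2_eq_square algebra_simps)
  also have "\<dots> = (y - x)\<^sup>2 * (- 2 * (y\<^sup>2 - 2 * x * y - x\<^sup>2))"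
    unfolding j[symmetric] j'[symmetric] by (simp add: power2_eq_square algebra_simps)
  finally have eq: "C\<^sup>2 * (-1) ^ j = 2 * (y - x)\<^sup>2"
    by (simp add: norm)
  then have "even (C\<^sup>2 * (-1) ^ j)"
    by simp
  \<comment> \<open>The sign does not affect parity, so C is even; C^2 = 4D^2 then leaves a factor 2
    in (y - x)^2.\<close>
  then obtain D where "C = 2 * D"
    by auto
  with eq have "(y - x)\<^sup>2 = 2 * (D\<^sup>2 * (-1) ^ j)"
    by (simp add: power2_eq_square)
  then have "even ((y - x)\<^sup>2)"
    by simp
  then show False
    using odd_pell_Suc_diff[of m] by (simp add: x_def y_def)
qed

end
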